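(* Every Gruenhage compact Hausdorff space has the Bishop property.
   Context: A compact Hausdorff space $K$ is called Gruenhage if there exist a sequence $(\mathscr{U}_n)_{n=1}^\infty$ of families of open subsets of $K$ and a sequence $(R_n)_{n=1}^\infty$ of open subsets of $K$ such that (1) $U\cap V=R_n$ whenever $n\in\mathbb{N}$ and $U,V\in\mathscr{U}_n$ are distinct, and (2) if $s,t\in K$ are distinct, then $\{s,t\}\cap U$ is a singleton for some $m\in\mathbb{N}$ and some $U\in\mathscr{U}_m$. For a compact Hausdorff space $K$, $C(K)$ is the Banach space of all scalar-valued (real or complex) continuous functions on $K$ with the supremum norm. For $f\in C(K)$, $\operatorname{supp} f$ is the closure of $\{t\in K: f(t)\neq 0\}$. For distinct $f,g\in C(K)$ write $f\prec g$ if $f$ and $g$ agree on $\operatorname{supp} f$; this is a strict partial order. A subset $F\subseteq C(K)$ is a $\prec$-chain if for all distinct $f,g\in F$ either $f\prec g$ or $g\prec f$. The space $K$ has the Bishop property if $\inf\{\|f-g\| : f,g\in F,\ f\prec g\}=0$ for every norm-bounded uncountable $\prec$-chain $F$ in $C(K)$. *)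

theory Defs
  imports "HOL-Analysis.Bounded_Continuous_Function"
begin

(* Compact Hausdorff spaces are types of class t2_space whose UNIV is compact.  On such a space
   every continuous scalar function is bounded, so the library's Banach space of bounded
   continuous functions with the supremum norm is C(K). *)

definition gruenhage :: "'a::topological_space itself \<Rightarrow> bool" where
  "gruenhage _ \<longleftrightarrow>
    (\<exists>(\<U> :: nat \<Rightarrow> 'a set set) (R :: nat \<Rightarrow> 'a set).
      (\<forall>n. \<forall>U\<in>\<U> n. open U) \<and>
      (\<forall>n. open (R n)) \<and>
      (\<forall>n. \<forall>U\<in>\<U> n. \<forall>V\<in>\<U> n. U \<noteq> V \<longrightarrow> U \<inter> V = R n) \<and>
      (\<forall>s t. s \<noteq> t \<longrightarrow> (\<exists>m. \<exists>U\<in>\<U> m. is_singleton ({s, t} \<inter> U))))"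

definition supp :: "('a::topological_space \<Rightarrow>\<^sub>C 'b::real_normed_vector) \<Rightarrow> 'a set" where
  "supp f = closure {t. apply_bcontfun f t \<noteq> 0}"

definition prec ::
    "('a::topological_space \<Rightarrow>\<^sub>C 'b::real_normed_vector) \<Rightarrow> ('a \<Rightarrow>\<^sub>C 'b) \<Rightarrow> bool"
    (infix \<open>\<prec>\<close> 50) where
  "f \<prec> g \<longleftrightarrow> f \<noteq> g \<and> (\<forall>t\<in>supp f. apply_bcontfun f t = apply_bcontfun g t)"

definition prec_chain :: "('a::topological_space \<Rightarrow>\<^sub>C 'b::real_normed_vector) set \<Rightarrow> bool" where
  "prec_chain F \<longleftrightarrow> (\<forall>f\<in>F. \<forall>g\<in>F. f \<noteq> g \<longrightarrow> f \<prec> g \<or> g \<prec> f)"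

(* The second argument is the scalar field.  An uncountable chain contains two distinct, hence
   comparable, functions, so the infimum is over a nonempty set of nonnegative reals. *)

definition bishop_property ::
    "'a::topological_space itself \<Rightarrow> 'b::real_normed_field itself \<Rightarrow> bool" where
  "bishop_property _ _ \<longleftrightarrow>
    (\<forall>F :: ('a \<Rightarrow>\<^sub>C 'b) set.
      bounded F \<longrightarrow> uncountable F \<longrightarrow> prec_chain F \<longrightarrow>
      Inf {norm (f - g) | f g. f \<in> F \<and> g \<in> F \<and> f \<prec> g} = 0)"

end

theory Submission
  imports Defs
begin

text \<open>Suppose that \<open>F\<close> is an uncountable chain with \<open>norm (f - g) \<ge> \<delta> > 0\<close> whenever \<open>f \<prec> g\<close>. On
  the closed set \<open>Y\<close> of those points where every \<open>f \<in> F\<close> either vanishes or has modulus at least \<open>\<delta>\<close>,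
  the sets \<open>{\<bar>f\<bar> \<ge> \<delta>}\<close> are clopen, and \<open>f \<prec> g\<close> makes them strictly increasing: where \<open>f\<close> and \<open>g\<close>
  differ by \<open>\<delta>\<close>, \<open>f\<close> vanishes, and that point lies in \<open>Y\<close>.

  So it suffices that a Gruenhage compact space has no uncountable chain of clopen sets. Either some
  subchain, or the complements of one, has uncountable cofinality, or every subchain has a countable
  cofinal and a countable coinitial subset. In both cases, closing off under countably many operations
  (in the manner of a countable elementary submodel) yields disjoint nonempty closed sets \<open>A\<close>
  and \<open>B\<close> such that every finite cover by members of the \<open>n\<close>-th Gruenhage family which works near \<open>A\<close>
  or near \<open>B\<close> works near both. Shrinking the space step by step then keeps meeting \<open>A\<close> and \<open>B\<close>, while
  after step \<open>n\<close> no member of the \<open>n\<close>-th family splits what is left of \<open>A \<union> B\<close>; by compactness a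
  point of \<open>A\<close> and a point of \<open>B\<close> remain that are never separated.\<close>

section \<open>Chains of sets in a compact space\<close>

lemma chain_subset_mono: "chain_subset \<D> \<Longrightarrow> \<C> \<subseteq> \<D> \<Longrightarrow> chain_subset \<C>"
  by (auto simp: chain_subset_def)

text \<open>If no member lay in \<open>O'\<close>, the closed sets \<open>K - O'\<close> would be
  nonempty. In a chain a finite intersection is one of the members, so the finite intersection
  property would give a point of the intersection outside \<open>O'\<close>.\<close>

lemma compact_chain_Inter_subset:
  fixes \<K> :: "'a::topological_space set set"
  assumes "compact (UNIV :: 'a set)" "chain_subset \<K>" "\<K> \<noteq> {}"
    and closed: "\<forall>K\<in>\<K>. closed K" and "open O'" "\<Inter>\<K> \<subseteq> O'"
  obtains K where "K \<in> \<K>" "K \<subseteq> O'"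
proof (rule ccontr)
  assume "\<not> thesis"
  then have no: "\<forall>K\<in>\<K>. K - O' \<noteq> {}" using that by blast
  have "UNIV \<inter> (\<Inter>K\<in>\<K>. K - O') \<noteq> {}"
  proof (rule compact_imp_fip_image[OF assms(1)])
    show "closed (K - O')" if "K \<in> \<K>" for K using that closed \<open>open O'\<close> by blast
    show "UNIV \<inter> (\<Inter>K\<in>\<K>'. K - O') \<noteq> {}" if "finite \<K>'" "\<K>' \<subseteq> \<K>" for \<K>'
    proof (cases "\<K>' = {}")
      case False
      have "subset.chain UNIV \<K>'"
        using assms(2) that(2) by (auto simp: chain_subset_def subset_chain_def)
      then have "\<Inter>\<K>' \<in> \<K>'" using that(1) False by (intro Inter_in_chain) auto
      then have "\<Inter>\<K>' - O' \<noteq> {}" using no that(2) by blast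
      then show ?thesis by blast
    qed auto
  qed
  then show False using assms(3,6) by blast
qed

lemma compact_chain_Inter_nonempty:
  fixes \<K> :: "'a::topological_space set set"
  assumes "compact (UNIV :: 'a set)" "chain_subset \<K>" "\<K> \<noteq> {}"
    and "\<forall>K\<in>\<K>. closed K" "{} \<notin> \<K>"
  shows "\<Inter>\<K> \<noteq> {}"
proof
  assume "\<Inter>\<K> = {}"
  then obtain K where "K \<in> \<K>" "K \<subseteq> {}"
    using compact_chain_Inter_subset[OF assms(1-4), of "{}"] by auto
  then show False using assms(5) by auto
qed

text \<open>A Skolem hull, standing in for a countable elementary submodel. The values of
  \<open>g\<close> are countable sets, so that countably many operations can be packed into it; its
  arguments will be a set to be shrunk and members of the chain. The hull is the union of countably
  many stages, and any three of its elements already occur at a common stage.\<close>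

lemma countable_closure:
  fixes g :: "'x \<Rightarrow> 'x \<Rightarrow> 'x \<Rightarrow> 'x set"
  assumes "countable A" and g: "\<And>x y z. countable (g x y z)"
  shows "\<exists>Z. A \<subseteq> Z \<and> countable Z \<and> (\<forall>x\<in>Z. \<forall>y\<in>Z. \<forall>z\<in>Z. g x y z \<subseteq> Z)"
proof -
  define step where "step = (\<lambda>S. S \<union> (\<Union>x\<in>S. \<Union>y\<in>S. \<Union>z\<in>S. g x y z))"
  define S where "S i = (step ^^ i) A" for i
  have Suc: "S (Suc i) = step (S i)" for i by (simp add: S_def)
  have inc: "S i \<subseteq> S j" if "i \<le> j" for i j
    using that by (rule lift_Suc_mono_le[rotated]) (auto simp: Suc step_def)
  have "countable (S i)" for i
    by (induction i) (auto simp: Suc, auto simp: S_def step_def assms(1) intro!: countable_UN g)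
  moreover have "g x y z \<subseteq> (\<Union>i. S i)"
    if xyz: "x \<in> (\<Union>i. S i)" "y \<in> (\<Union>i. S i)" "z \<in> (\<Union>i. S i)" for x y z
  proof -
    obtain i j k where "x \<in> S i" "y \<in> S j" "z \<in> S k" using xyz by blast
    then have "x \<in> S (i + j + k)" "y \<in> S (i + j + k)" "z \<in> S (i + j + k)"
      using inc[of i "i + j + k"] inc[of j "i + j + k"] inc[of k "i + j + k"] by auto
    then have "g x y z \<subseteq> S (Suc (i + j + k))" unfolding Suc step_def by blast
    then show ?thesis by blast
  qed
  moreover have "A \<subseteq> (\<Union>i. S i)" using S_def[of 0] by auto
  ultimately show ?thesis by (intro exI[of _ "\<Union>i. S i"]) auto
qed

section \<open>Covers by members of a Gruenhage family\<close>

text \<open>The set \<open>R\<close> comes for free, so \<open>m\<close> counts only members of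
  \<open>\<U>\<close>. The explicit bound lets coverability pass to unions of chains and allows a
  minimal \<open>m\<close> to be chosen.\<close>

definition cov :: "'a set set \<Rightarrow> 'a set \<Rightarrow> nat \<Rightarrow> 'a set \<Rightarrow> bool" where
  "cov \<U> R m S \<longleftrightarrow> (\<exists>F\<subseteq>\<U>. finite F \<and> card F \<le> m \<and> S \<subseteq> R \<union> \<Union>F)"

definition pieces :: "'a set set \<Rightarrow> 'a set \<Rightarrow> 'a set \<Rightarrow> 'a set set" where
  "pieces \<U> R S = {U \<in> \<U>. \<not> S \<inter> U \<subseteq> R}"

text \<open>Since the members of \<open>\<U>\<close> are disjoint outside \<open>R\<close>, none of them splits the part of the result
  inside \<open>W\<close>. If a cover by fewer members is impossible, the removed sets do not cover \<open>Q \<inter> W\<close>.\<close>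

definition trim :: "'a set set \<Rightarrow> 'a set \<Rightarrow> 'a set \<Rightarrow> 'a set \<Rightarrow> 'a set" where
  "trim \<U> R Q W =
    Q - (R \<union> \<Union>(pieces \<U> R (Q \<inter> W) - {SOME U. U \<in> pieces \<U> R (Q \<inter> W)}))"

lemma cov_mono: "cov \<U> R m S \<Longrightarrow> S' \<subseteq> S \<Longrightarrow> cov \<U> R m S'"
  unfolding cov_def by (meson subset_trans)

text \<open>A point outside \<open>R\<close> lies in at most one member of \<open>\<U>\<close>, so
  every cover must contain all pieces. Conversely the pieces suffice as soon as all of
  \<open>\<U>\<close> does: they form the least cover.\<close>

lemma cov_iff_pieces:
  assumes "\<forall>U\<in>\<U>. \<forall>V\<in>\<U>. U \<noteq> V \<longrightarrow> U \<inter> V = R"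
  shows "cov \<U> R m S \<longleftrightarrow>
    S \<subseteq> R \<union> \<Union>\<U> \<and> finite (pieces \<U> R S) \<and> card (pieces \<U> R S) \<le> m"
proof
  assume "cov \<U> R m S"
  then obtain F where F: "F \<subseteq> \<U>" "finite F" "card F \<le> m" "S \<subseteq> R \<union> \<Union>F"
    unfolding cov_def by blast
  have "pieces \<U> R S \<subseteq> F"
  proof
    fix U assume "U \<in> pieces \<U> R S"
    then obtain x where x: "U \<in> \<U>" "x \<in> S" "x \<in> U" "x \<notin> R" unfolding pieces_def by blast
    then obtain V where V: "V \<in> F" "x \<in> V" using F(4) by blast
    then have "U \<noteq> V \<Longrightarrow> U \<inter> V = R" using assms x(1) F(1) by (meson subsetD)
    then have "U = V" using x V by blast
    then show "U \<in> F" using V by simp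
  qed
  then have "finite (pieces \<U> R S)" "card (pieces \<U> R S) \<le> m"
    using F(2,3) by (auto intro: finite_subset dest: card_mono)
  moreover have "S \<subseteq> R \<union> \<Union>\<U>" using F(1,4) by blast
  ultimately show "S \<subseteq> R \<union> \<Union>\<U> \<and> finite (pieces \<U> R S) \<and> card (pieces \<U> R S) \<le> m"
    by blast
next
  assume "S \<subseteq> R \<union> \<Union>\<U> \<and> finite (pieces \<U> R S) \<and> card (pieces \<U> R S) \<le> m"
  moreover have "S \<subseteq> R \<union> \<Union>(pieces \<U> R S)" if "S \<subseteq> R \<union> \<Union>\<U>"
    using that unfolding pieces_def by blast
  moreover have "pieces \<U> R S \<subseteq> \<U>" unfolding pieces_def by blast
  ultimately show "cov \<U> R m S" unfolding cov_def by blast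
qed

text \<open>Pieces grow with the set, and a finite set of pieces of the union already consists of
  pieces of a single \<open>S\<close>. Hence the union cannot have \<open>m + 1\<close>
  pieces.\<close>

lemma cov_chain_Union:
  assumes "\<forall>U\<in>\<U>. \<forall>V\<in>\<U>. U \<noteq> V \<longrightarrow> U \<inter> V = R"
    and "chain_subset \<S>" "\<S> \<noteq> {}" and cov: "\<forall>S\<in>\<S>. cov \<U> R m S"
  shows "cov \<U> R m (\<Union>\<S>)"
proof -
  have bound: "card F \<le> m" if F: "finite F" "F \<subseteq> pieces \<U> R (\<Union>\<S>)" for F
  proof -
    have "subset.chain UNIV (pieces \<U> R ` \<S>)"
      unfolding subset_chain_def
    proof (intro conjI ballI)
      fix X Y assume "X \<in> pieces \<U> R ` \<S>" "Y \<in> pieces \<U> R ` \<S>"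
      then obtain S T where "S \<in> \<S>" "T \<in> \<S>" "X = pieces \<U> R S" "Y = pieces \<U> R T" by blast
      moreover have "S \<subseteq> T \<or> T \<subseteq> S" using calculation assms(2) by (auto simp: chain_subset_def)
      ultimately show "X \<subseteq> Y \<or> Y \<subseteq> X" unfolding pieces_def by blast
    qed simp
    moreover have "F \<subseteq> \<Union>(pieces \<U> R ` \<S>)" using F(2) unfolding pieces_def by blast
    moreover have "pieces \<U> R ` \<S> \<noteq> {}" using assms(3) by simp
    ultimately obtain X where "X \<in> pieces \<U> R ` \<S>" "F \<subseteq> X"
      using finite_subset_Union_chain[OF F(1), of "pieces \<U> R ` \<S>" UNIV] by metis
    then obtain S where "S \<in> \<S>" "F \<subseteq> pieces \<U> R S" by blast
    moreover from this have "finite (pieces \<U> R S)" "card (pieces \<U> R S) \<le> m"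
      using cov cov_iff_pieces[OF assms(1), of m S] by blast+
    ultimately show ?thesis using card_mono le_trans by blast
  qed
  have "finite (pieces \<U> R (\<Union>\<S>))"
    using bound infinite_arbitrarily_large[of "pieces \<U> R (\<Union>\<S>)" "Suc m"] by fastforce
  moreover have "\<Union>\<S> \<subseteq> R \<union> \<Union>\<U>"
    using cov cov_iff_pieces[OF assms(1), of m] by blast
  ultimately show ?thesis using bound cov_iff_pieces[OF assms(1), of m] by blast
qed

lemma cov_compact:
  assumes "compact S" "\<forall>U\<in>\<U>. open U" "open R" "S \<subseteq> R \<union> \<Union>\<U>"
  shows "\<exists>m. cov \<U> R m S"
proof -
  have "S \<subseteq> \<Union>(insert R \<U>)" using assms(4) by simp
  moreover have "\<And>B. B \<in> insert R \<U> \<Longrightarrow> open B" using assms(2,3) by blast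
  ultimately obtain F where F: "F \<subseteq> insert R \<U>" "finite F" "S \<subseteq> \<Union>F"
    by (rule compactE[OF assms(1)])
  have "F - {R} \<subseteq> \<U>" "finite (F - {R})" "S \<subseteq> R \<union> \<Union>(F - {R})"
    using F by blast+
  then show ?thesis unfolding cov_def by blast
qed

text \<open>A cover of \<open>Q \<inter> \<Inter>\<K>\<close> together with \<open>- Q\<close> is an
  open set around \<open>\<Inter>\<K>\<close>, so by compactness it contains some
  \<open>K\<close>.\<close>

lemma cov_chain_Inter:
  fixes \<K> :: "'a::topological_space set set"
  assumes "compact (UNIV :: 'a set)" "\<forall>U\<in>\<U>. open U" "open R"
    and "chain_subset \<K>" "\<K> \<noteq> {}" "\<forall>K\<in>\<K>. closed K"
    and "closed Q" "cov \<U> R m (Q \<inter> \<Inter>\<K>)"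
  shows "\<exists>K\<in>\<K>. cov \<U> R m (Q \<inter> K)"
proof -
  obtain F where F: "F \<subseteq> \<U>" "finite F" "card F \<le> m" "Q \<inter> \<Inter>\<K> \<subseteq> R \<union> \<Union>F"
    using assms(8) unfolding cov_def by blast
  have "open (- Q \<union> (R \<union> \<Union>F))" 
    using assms(2,3,7) F(1) by (intro open_Un open_Union) (auto simp: open_Compl)
  moreover have "\<Inter>\<K> \<subseteq> - Q \<union> (R \<union> \<Union>F)" using F(4) by blast
  ultimately obtain K where "K \<in> \<K>" "K \<subseteq> - Q \<union> (R \<union> \<Union>F)"
    by (rule compact_chain_Inter_subset[OF assms(1,4-6)])
  moreover from this have "Q \<inter> K \<subseteq> R \<union> \<Union>F" by blast
  then have "cov \<U> R m (Q \<inter> K)" unfolding cov_def using F(1-3) by blast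
  ultimately show ?thesis by blast
qed

lemma closed_trim:
  assumes "\<forall>U\<in>\<U>. open U" "open R" "closed Q"
  shows "closed (trim \<U> R Q W)"
proof -
  have "open (\<Union>(pieces \<U> R (Q \<inter> W) - X))" for X
    using assms(1) by (intro open_Union) (simp add: pieces_def)
  then show ?thesis unfolding trim_def using assms(2,3) by (intro closed_Diff open_Un)
qed

section \<open>Closed sets which a Gruenhage family cannot tell apart\<close>

text \<open>\<open>R_subset\<close> follows from \<open>inter_U\<close> only for families with at
  least two members. It ensures that a set inside \<open>R n\<close> is split by no member of the
  family.\<close>

locale gruenhage_family =
  fixes \<U> :: "nat \<Rightarrow> 'a::topological_space set set" and R :: "nat \<Rightarrow> 'a set"
  assumes compact_space: "compact (UNIV :: 'a set)"
    and open_U: "\<forall>U\<in>\<U> n. open U"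
    and open_R: "open (R n)"
    and inter_U: "\<forall>U\<in>\<U> n. \<forall>V\<in>\<U> n. U \<noteq> V \<longrightarrow> U \<inter> V = R n"
    and R_subset: "\<forall>U\<in>\<U> n. R n \<subseteq> U"
    and separates: "s \<noteq> t \<Longrightarrow> \<exists>m. \<exists>U\<in>\<U> m. is_singleton ({s, t} \<inter> U)"
begin

text \<open>If the family covers neither \<open>Q \<inter> A\<close> nor
  \<open>Q \<inter> B\<close>, removing its whole union leaves points of both. Otherwise let
  \<open>m\<close> be least such that \<open>m\<close> members cover \<open>Q \<inter> W\<close> for
  some \<open>W\<close> in \<open>\<W>\<close>. By \<open>reflect\<close>, fewer members cover
  neither \<open>Q \<inter> A\<close> nor \<open>Q \<inter> B\<close>, so removing
  \<open>R n\<close> and all pieces but one still leaves points of both, and what is left of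
  \<open>A \<union> B\<close> lies in that one piece, outside \<open>R n\<close>.\<close>

lemma unsplit_step:
  assumes closed: "\<And>Q. Q \<in> \<Q> \<Longrightarrow> closed Q" and "closed A" "closed B"
    and remove: "\<And>Q. Q \<in> \<Q> \<Longrightarrow> Q - (R n \<union> \<Union>(\<U> n)) \<in> \<Q>"
    and trim: "\<And>Q W. Q \<in> \<Q> \<Longrightarrow> W \<in> \<W> \<Longrightarrow> trim (\<U> n) (R n) Q W \<in> \<Q>"
    and W: "\<And>W. W \<in> \<W> \<Longrightarrow> A \<union> B \<subseteq> W"
    and reflect: "\<And>Q m. Q \<in> \<Q> \<Longrightarrow>
      cov (\<U> n) (R n) m (Q \<inter> A) \<or> cov (\<U> n) (R n) m (Q \<inter> B) \<Longrightarrow>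
      \<exists>W\<in>\<W>. cov (\<U> n) (R n) m (Q \<inter> W)"
    and Q: "Q \<in> \<Q>" "Q \<inter> A \<noteq> {}" "Q \<inter> B \<noteq> {}"
  shows "\<exists>Q'\<in>\<Q>. Q' \<subseteq> Q \<and> Q' \<inter> A \<noteq> {} \<and> Q' \<inter> B \<noteq> {} \<and>
    (\<forall>U\<in>\<U> n. Q' \<inter> (A \<union> B) \<subseteq> U \<or> Q' \<inter> (A \<union> B) \<inter> U = {})"
proof (cases "Q \<inter> A \<subseteq> R n \<union> \<Union>(\<U> n) \<or> Q \<inter> B \<subseteq> R n \<union> \<Union>(\<U> n)")
  case False
  then have "(Q - (R n \<union> \<Union>(\<U> n))) \<inter> A \<noteq> {}" "(Q - (R n \<union> \<Union>(\<U> n))) \<inter> B \<noteq> {}"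
    by blast+
  moreover have "\<forall>U\<in>\<U> n. (Q - (R n \<union> \<Union>(\<U> n))) \<inter> (A \<union> B) \<inter> U = {}" by blast
  ultimately show ?thesis using remove[OF Q(1)] by (meson Diff_subset)
next
  case True
  have compact: "compact (Q \<inter> A)" "compact (Q \<inter> B)"
    using closed[OF Q(1)] \<open>closed A\<close> \<open>closed B\<close> compact_space
    by (metis closed_Int compact_Int_closed inf_top_left)+
  define P where "P m \<longleftrightarrow> (\<exists>W\<in>\<W>. cov (\<U> n) (R n) m (Q \<inter> W))" for m
  have "\<exists>m. cov (\<U> n) (R n) m (Q \<inter> A) \<or> cov (\<U> n) (R n) m (Q \<inter> B)"
    using True cov_compact[OF compact(1) open_U[of n] open_R[of n]]
      cov_compact[OF compact(2) open_U[of n] open_R[of n]] by blast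
  then have "\<exists>m. P m" using reflect[OF Q(1)] unfolding P_def by blast
  define m where "m = (LEAST m. P m)"
  have Pm: "P m" using \<open>\<exists>m. P m\<close> unfolding m_def by (rule LeastI_ex)
  have least: "\<not> P k" if "k < m" for k using that not_less_Least unfolding m_def by blast
  obtain W where W': "W \<in> \<W>" "cov (\<U> n) (R n) m (Q \<inter> W)" using Pm P_def by blast
  define F where "F = pieces (\<U> n) (R n) (Q \<inter> W)"
  \<comment> \<open>This must be the same choice as in \<open>trim\<close>; then the trimmed set is
    again in \<open>\<Q>\<close>.\<close>
  define U0 where "U0 = (SOME U. U \<in> F)"
  have F: "finite F" "card F \<le> m" and QW: "Q \<inter> W \<subseteq> R n \<union> \<Union>(\<U> n)"
    using W'(2) cov_iff_pieces[OF inter_U[of n]] unfolding F_def by auto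
  have QF: "Q \<inter> W \<subseteq> R n \<union> \<Union>F" and FU: "F \<subseteq> \<U> n"
    using QW unfolding F_def pieces_def by blast+
  have AB: "A \<subseteq> W" "B \<subseteq> W" using W[OF W'(1)] by auto
  show ?thesis
  proof (cases "F = {}")
    case True
    then have "Q \<inter> (A \<union> B) \<subseteq> R n" using QF AB by blast
    then have "\<forall>U\<in>\<U> n. Q \<inter> (A \<union> B) \<subseteq> U" using R_subset[of n] by blast
    then show ?thesis using Q by blast
  next
    case False
    then have U0: "U0 \<in> F" unfolding U0_def by (rule some_in_eq[THEN iffD2])
    define Q' where "Q' = Q - (R n \<union> \<Union>(F - {U0}))"
    have "Q' \<in> \<Q>" using trim[OF Q(1) W'(1)] unfolding Q'_def trim_def F_def U0_def .
    have card: "card (F - {U0}) < m"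
      using F U0 by (meson card_Diff1_less less_le_trans)
    have meets: "Q' \<inter> K \<noteq> {}" if "K = A \<or> K = B" for K
    proof
      assume "Q' \<inter> K = {}"
      then have "Q \<inter> K \<subseteq> R n \<union> \<Union>(F - {U0})" unfolding Q'_def by blast
      then have "cov (\<U> n) (R n) (card (F - {U0})) (Q \<inter> K)"
        unfolding cov_def using F(1) FU by (intro exI[of _ "F - {U0}"]) auto
      then have "P (card (F - {U0}))"
        using reflect[OF Q(1)] that unfolding P_def by blast
      then show False using least card by blast
    qed
    have sub: "Q' \<inter> (A \<union> B) \<subseteq> U0 - R n" using QF AB unfolding Q'_def by blast
    have "Q' \<inter> (A \<union> B) \<subseteq> U \<or> Q' \<inter> (A \<union> B) \<inter> U = {}" if "U \<in> \<U> n" for U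
      using sub inter_U[of n] that U0 FU by blast
    moreover have "Q' \<subseteq> Q" unfolding Q'_def by blast
    moreover have "Q' \<inter> A \<noteq> {}" "Q' \<inter> B \<noteq> {}" using meets by simp_all
    ultimately show ?thesis using \<open>Q' \<in> \<Q>\<close> by blast
  qed
qed

text \<open>Iterating \<open>unsplit_step\<close> gives decreasing closed sets meeting
  \<open>A\<close> and \<open>B\<close>; by compactness a point of \<open>A\<close> and a point of
  \<open>B\<close> survive every step. They are distinct, yet a member of the \<open>n\<close>-th
  family separating them would split the set obtained at step \<open>n\<close>. Only the sets
  reached in this way have to be in \<open>\<Q>\<close>, which therefore fits into a countable
  hull.\<close>

lemma no_twins:
  assumes "UNIV \<in> \<Q>" and closed: "\<And>Q. Q \<in> \<Q> \<Longrightarrow> closed Q" and AB: "closed A" "closed B"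
    "A \<noteq> {}" "B \<noteq> {}" "A \<inter> B = {}"
    and remove: "\<And>Q n. Q \<in> \<Q> \<Longrightarrow> Q - (R n \<union> \<Union>(\<U> n)) \<in> \<Q>"
    and trim: "\<And>Q W n. Q \<in> \<Q> \<Longrightarrow> W \<in> \<W> \<Longrightarrow> trim (\<U> n) (R n) Q W \<in> \<Q>"
    and W: "\<And>W. W \<in> \<W> \<Longrightarrow> A \<union> B \<subseteq> W"
    and reflect: "\<And>Q m n. Q \<in> \<Q> \<Longrightarrow>
      cov (\<U> n) (R n) m (Q \<inter> A) \<or> cov (\<U> n) (R n) m (Q \<inter> B) \<Longrightarrow>
      \<exists>W\<in>\<W>. cov (\<U> n) (R n) m (Q \<inter> W)"
  shows False
proof -
  let ?ok = "\<lambda>Q. Q \<in> \<Q> \<and> Q \<inter> A \<noteq> {} \<and> Q \<inter> B \<noteq> {}"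
  let ?unsplit = "\<lambda>n Q. \<forall>U\<in>\<U> n. Q \<inter> (A \<union> B) \<subseteq> U \<or> Q \<inter> (A \<union> B) \<inter> U = {}"
  have "\<exists>Q. \<forall>n. ?ok (Q n) \<and> (Q (Suc n) \<subseteq> Q n \<and> ?unsplit n (Q (Suc n)))"
  proof (rule dependent_nat_choice)
    show "\<exists>Q. ?ok Q" using assms(1) AB(3,4) by (intro exI[of _ UNIV]) simp
    show "\<exists>Q'. ?ok Q' \<and> (Q' \<subseteq> Q \<and> ?unsplit n Q')" if "?ok Q" for Q n
      using unsplit_step[of \<Q> A B n \<W> Q] closed AB(1,2) remove trim W reflect that by blast
  qed
  then obtain Q where Q: "\<And>n. ?ok (Q n)" "\<And>n. Q (Suc n) \<subseteq> Q n"
    "\<And>n. ?unsplit n (Q (Suc n))" by blast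
  have dec: "Q j \<subseteq> Q i" if "i \<le> j" for i j
    using that Q(2) by (rule lift_Suc_antimono_le[rotated])
  have pt: "(\<Inter>n. Q n \<inter> K) \<noteq> {}" if "closed K" "\<And>n. Q n \<inter> K \<noteq> {}" for K
  proof (rule compact_chain_Inter_nonempty[OF compact_space])
    have "Q i \<inter> K \<subseteq> Q j \<inter> K \<or> Q j \<inter> K \<subseteq> Q i \<inter> K" for i j
      using dec[of i j] dec[of j i] nat_le_linear[of i j] by blast
    then show "chain_subset (range (\<lambda>n. Q n \<inter> K))" unfolding chain_subset_def by blast
    show "\<forall>S\<in>range (\<lambda>n. Q n \<inter> K). closed S" using Q(1) closed \<open>closed K\<close> by auto
    show "{} \<notin> range (\<lambda>n. Q n \<inter> K)" using that(2) by auto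
  qed simp
  have "(\<Inter>n. Q n \<inter> A) \<noteq> {}" "(\<Inter>n. Q n \<inter> B) \<noteq> {}"
    by (rule pt, rule AB, use Q(1) in blast)+
  then obtain x y where "x \<in> (\<Inter>n. Q n \<inter> A)" "y \<in> (\<Inter>n. Q n \<inter> B)" by blast
  then have xy: "\<And>n. x \<in> Q n \<inter> A" "\<And>n. y \<in> Q n \<inter> B" by blast+
  then have "x \<noteq> y" using AB(5) by blast
  then obtain n U where U: "U \<in> \<U> n" "is_singleton ({x, y} \<inter> U)" using separates by blast
  then obtain z where "{x, y} \<inter> U = {z}" by (elim is_singletonE)
  then have "(x \<in> U) \<noteq> (y \<in> U)"
    using \<open>x \<noteq> y\<close> by (auto simp: Int_insert_left split: if_splits)
  moreover have "Q (Suc n) \<inter> (A \<union> B) \<subseteq> U \<or> Q (Suc n) \<inter> (A \<union> B) \<inter> U = {}"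
    using Q(3) U(1) by (rule bspec)
  ultimately show False using xy[of "Suc n"] by blast
qed

text \<open>A countable set of points closed under the choices made below plays the role of a countable
  elementary submodel: an element of the chain above all of it cannot be told apart from an
  element above all of a larger such set.\<close>

lemma countably_directed_chain_False:
  fixes \<C> :: "'a set set"
  assumes chain: "chain_subset \<C>" and diff: "\<forall>C\<in>\<C>. \<forall>D\<in>\<C>. closed (C - D)"
    and unbounded: "\<And>\<D>. \<D> \<subseteq> \<C> \<Longrightarrow> countable \<D> \<Longrightarrow> \<exists>C\<in>\<C>. \<forall>D\<in>\<D>. D \<subset> C"
  shows False
proof -
  let ?cov = "\<lambda>n. cov (\<U> n) (R n)"
  define G where "G = \<Union>\<C>"
  \<comment> \<open>A counterexample to coverability, chosen so that the hull contains one whenever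
    one exists.\<close>
  define above where "above Q d n m = (SOME k. k \<in> \<C> \<and> \<not> ?cov n m (Q \<inter> (k - d)))" for Q d :: "'a set" and n m
  \<comment> \<open>This choice depends only on \<open>Q\<close>, \<open>n\<close> and
    \<open>m\<close>. So it lies in \<open>Z\<close> whenever \<open>Q\<close> does, even if the
    cover was found near \<open>B\<close> by means of the larger hull \<open>Z'\<close>.\<close>
  define small where "small Q n m = (SOME d. d \<in> \<C> \<and> ?cov n m (Q \<inter> (G - d)))" for Q :: "'a set" and n m
  define g where "g Q d e =
      range (\<lambda>n. Q - (R n \<union> \<Union>(\<U> n))) \<union> range (\<lambda>n. trim (\<U> n) (R n) Q (G - d))
      \<union> (\<Union>n m. {above Q d n m}) \<union> (\<Union>n m. {small Q n m})" for Q d e :: "'a set"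
  have g: "countable (g x y z)" for x y z unfolding g_def by (intro countable_Un countable_UN) simp_all
  have bound: "\<exists>C\<in>\<C>. \<forall>D\<in>Z \<inter> \<C>. D \<subset> C" if "countable Z" for Z
    using unbounded[of "Z \<inter> \<C>"] that by (simp add: countable_Int1)
  obtain d0 where d0: "d0 \<in> \<C>" using bound[of "{}"] by auto
  have closure: "\<exists>Z. X \<subseteq> Z \<and> countable Z \<and> (\<forall>x\<in>Z. \<forall>y\<in>Z. \<forall>z\<in>Z. g x y z \<subseteq> Z)"
    if "countable X" for X using that g by (rule countable_closure)
  obtain Z where Z: "{UNIV, d0} \<subseteq> Z" "countable Z" "\<forall>x\<in>Z. \<forall>y\<in>Z. \<forall>z\<in>Z. g x y z \<subseteq> Z"
    using closure[of "{UNIV, d0}"] by auto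
  obtain l where l: "l \<in> \<C>" "\<forall>D\<in>Z \<inter> \<C>. D \<subset> l" using bound[OF Z(2)] by blast
  \<comment> \<open>Putting \<open>l\<close> into \<open>Z'\<close> makes
    \<open>A \<subseteq> l\<close> disjoint from \<open>B\<close>, which avoids all chain members in
    \<open>Z'\<close>.\<close>
  obtain Z' where Z': "insert l Z \<subseteq> Z'" "countable Z'" "\<forall>x\<in>Z'. \<forall>y\<in>Z'. \<forall>z\<in>Z'. g x y z \<subseteq> Z'"
    using closure[of "insert l Z"] Z(2) by auto
  obtain l' where l': "l' \<in> \<C>" "\<forall>D\<in>Z' \<inter> \<C>. D \<subset> l'" using bound[OF Z'(2)] by blast
  have closedZ: "above Q d n m \<in> X" "small Q n m \<in> X"
    "Q - (R n \<union> \<Union>(\<U> n)) \<in> X" "trim (\<U> n) (R n) Q (G - d) \<in> X"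
    if "X = Z \<or> X = Z'" "Q \<in> X" "d \<in> X" for X Q d n m
  proof -
    have sub: "g Q d d \<subseteq> X" using that Z(3) Z'(3) by blast
    have "above Q d n m \<in> g Q d d" "small Q n m \<in> g Q d d"
      "Q - (R n \<union> \<Union>(\<U> n)) \<in> g Q d d" "trim (\<U> n) (R n) Q (G - d) \<in> g Q d d"
      unfolding g_def by blast+
    then show "above Q d n m \<in> X" "small Q n m \<in> X"
      "Q - (R n \<union> \<Union>(\<U> n)) \<in> X" "trim (\<U> n) (R n) Q (G - d) \<in> X"
      using sub by (simp_all only: subset_eq)
  qed
  \<comment> \<open>The set \<open>c - \<Union>(X \<inter> \<C>)\<close> is the intersection of the
    chain of nonempty closed sets \<open>c - d\<close>, to which the compactness lemmas
    apply.\<close>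
  have end_pieces: "closed (c - \<Union>(X \<inter> \<C>))" "c - \<Union>(X \<inter> \<C>) \<noteq> {}"
    "\<And>Q n m. closed Q \<Longrightarrow> ?cov n m (Q \<inter> (c - \<Union>(X \<inter> \<C>))) \<Longrightarrow>
      \<exists>d\<in>X \<inter> \<C>. ?cov n m (Q \<inter> (c - d))"
    if X: "d0 \<in> X" and c: "c \<in> \<C>" "\<forall>D\<in>X \<inter> \<C>. D \<subset> c" for X c
  proof -
    let ?K = "(\<lambda>d. c - d) ` (X \<inter> \<C>)"
    have K: "\<Inter>?K = c - \<Union>(X \<inter> \<C>)" using X d0 by blast
    have cl: "\<forall>K\<in>?K. closed K" using diff c(1) by blast
    have ch: "chain_subset ?K" using chain unfolding chain_subset_def by blast
    have ne: "?K \<noteq> {}" using X d0 by blast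
    show "closed (c - \<Union>(X \<inter> \<C>))" unfolding K[symmetric] using cl by blast
    have "{} \<notin> ?K" using c(2) by blast
    then show "c - \<Union>(X \<inter> \<C>) \<noteq> {}"
      unfolding K[symmetric] by (rule compact_chain_Inter_nonempty[OF compact_space ch ne cl])
    fix Q n m assume "closed Q" "?cov n m (Q \<inter> (c - \<Union>(X \<inter> \<C>)))"
    then have "\<exists>K\<in>?K. ?cov n m (Q \<inter> K)"
      unfolding K[symmetric] by (rule cov_chain_Inter[OF compact_space open_U open_R ch ne cl])
    then show "\<exists>d\<in>X \<inter> \<C>. ?cov n m (Q \<inter> (c - d))" by blast
  qed
  \<comment> \<open>A cover near the end piece first yields one of \<open>Q \<inter> (c - d)\<close>
    with \<open>d\<close> in \<open>X\<close>. If the same bound failed for some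
    \<open>k - d\<close>, the counterexample \<open>above Q d n m\<close> would be in
    \<open>X\<close>, hence below \<open>c\<close>, which is absurd. The bound then passes to the
    union over all \<open>k\<close>.\<close>
  have grow: "\<exists>d\<in>X \<inter> \<C>. ?cov n m (Q \<inter> (G - d))"
    if X: "X = Z \<or> X = Z'" "Q \<in> X" "closed Q" and c: "c \<in> \<C>" "\<forall>D\<in>X \<inter> \<C>. D \<subset> c"
      and cov: "?cov n m (Q \<inter> (c - \<Union>(X \<inter> \<C>)))" for X Q c n m
  proof -
    have "d0 \<in> X" using X(1) Z(1) Z'(1) by blast
    then obtain d where d: "d \<in> X" "d \<in> \<C>" "?cov n m (Q \<inter> (c - d))"
      using end_pieces(3)[OF _ c X(3) cov] by blast
    have "?cov n m (Q \<inter> (k - d))" if "k \<in> \<C>" for k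
    proof (rule ccontr)
      assume "\<not> ?cov n m (Q \<inter> (k - d))"
      then have k: "above Q d n m \<in> \<C> \<and> \<not> ?cov n m (Q \<inter> (above Q d n m - d))"
        using that someI[of "\<lambda>k. k \<in> \<C> \<and> \<not> ?cov n m (Q \<inter> (k - d))" k]
        unfolding above_def by simp
      moreover have "above Q d n m \<in> X" by (rule closedZ(1)[OF X(1,2) d(1)])
      ultimately have "above Q d n m \<subset> c" using c(2) by simp
      then have "Q \<inter> (above Q d n m - d) \<subseteq> Q \<inter> (c - d)" by blast
      then have "?cov n m (Q \<inter> (above Q d n m - d))" by (rule cov_mono[OF d(3)])
      then show False using k by simp
    qed
    then have "?cov n m (\<Union>((\<lambda>k. Q \<inter> (k - d)) ` \<C>))"
    proof (intro cov_chain_Union[OF inter_U])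
      show "chain_subset ((\<lambda>k. Q \<inter> (k - d)) ` \<C>)" using chain unfolding chain_subset_def by blast
    qed (use d0 in auto)
    moreover have "\<Union>((\<lambda>k. Q \<inter> (k - d)) ` \<C>) = Q \<inter> (G - d)" unfolding G_def by blast
    ultimately show ?thesis using d by auto
  qed
  define A B where "A = l - \<Union>(Z \<inter> \<C>)" and "B = l' - \<Union>(Z' \<inter> \<C>)"
  define \<Q> where "\<Q> = {Q \<in> Z. closed Q}"
  define \<W> where "\<W> = (\<lambda>d. G - d) ` (Z \<inter> \<C>)"
  show False
  proof (rule no_twins[of \<Q> A B \<W>])
    show "UNIV \<in> \<Q>" "\<And>Q. Q \<in> \<Q> \<Longrightarrow> closed Q" using Z(1) by (auto simp: \<Q>_def)
    have "d0 \<in> Z" "d0 \<in> Z'" using Z(1) Z'(1) by auto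
    then show "closed A" "closed B" "A \<noteq> {}" "B \<noteq> {}"
      unfolding A_def B_def using end_pieces(1,2) l l' by blast+
    show "A \<inter> B = {}" unfolding A_def B_def using l(1) Z'(1) by blast
    show "Q - (R n \<union> \<Union>(\<U> n)) \<in> \<Q>" if "Q \<in> \<Q>" for Q n
      using that closedZ(3)[of Z Q d0 n] \<open>d0 \<in> Z\<close> open_U[of n] open_R[of n]
      by (auto simp: \<Q>_def intro!: closed_Diff open_Un open_Union)
    show "trim (\<U> n) (R n) Q W \<in> \<Q>" if "Q \<in> \<Q>" "W \<in> \<W>" for Q W n
      using that closedZ(4)[of Z Q _ n] closed_trim[OF open_U open_R]
      by (auto simp: \<Q>_def \<W>_def)
    show "A \<union> B \<subseteq> W" if "W \<in> \<W>" for W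
      using that l(1) l'(1) Z'(1) unfolding A_def B_def \<W>_def G_def by blast
    show "\<exists>W\<in>\<W>. ?cov n m (Q \<inter> W)"
      if Q: "Q \<in> \<Q>" and "?cov n m (Q \<inter> A) \<or> ?cov n m (Q \<inter> B)" for Q m n
    proof -
      have Q': "Q \<in> Z" "Q \<in> Z'" "closed Q" using Q Z'(1) by (auto simp: \<Q>_def)
      have "\<exists>d\<in>\<C>. ?cov n m (Q \<inter> (G - d))"
        using that(2)
      proof
        assume "?cov n m (Q \<inter> A)"
        then show ?thesis
          using grow[OF _ Q'(1,3) l, of n m] unfolding A_def by blast
      next
        assume "?cov n m (Q \<inter> B)"
        then show ?thesis
          using grow[OF _ Q'(2,3) l', of n m] unfolding B_def by blast
      qed
      then have "small Q n m \<in> \<C> \<and> ?cov n m (Q \<inter> (G - small Q n m))"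
        using someI_ex[of "\<lambda>d. d \<in> \<C> \<and> ?cov n m (Q \<inter> (G - d))"]
        unfolding small_def Bex_def by simp
      then show ?thesis
        using closedZ(2)[of Z Q Q n m] Q'(1) unfolding \<W>_def by blast
    qed
  qed
qed

text \<open>A chain member \<open>l\<close> outside a countable hull \<open>Z\<close> cuts the chain
  members of \<open>Z\<close> into a lower part \<open>D\<close> and an upper part \<open>E\<close>.
  The closed sets just below and just above \<open>l\<close>, the intersections of all
  \<open>l - d\<close> and of all \<open>e - l\<close>, are the twins. Countable cofinal and
  coinitial subsets placed in the hull turn a cover on one side of \<open>l\<close> into a cover of
  some \<open>e - d\<close> around it.\<close>

lemma countable_cofinality_chain_False:
  fixes \<C> :: "'a set set"
  assumes chain: "chain_subset \<C>" and diff: "\<forall>C\<in>\<C>. \<forall>D\<in>\<C>. closed (C - D)"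
    and bounds: "{} \<in> \<C>" "Y \<in> \<C>" "\<forall>C\<in>\<C>. C \<subseteq> Y" and "uncountable \<C>"
    and cofinal: "\<And>\<D>. \<D> \<subseteq> \<C> \<Longrightarrow> \<exists>\<E>\<subseteq>\<D>. countable \<E> \<and> (\<forall>D\<in>\<D>. \<exists>E\<in>\<E>. D \<subseteq> E)"
    and coinitial: "\<And>\<D>. \<D> \<subseteq> \<C> \<Longrightarrow> \<exists>\<E>\<subseteq>\<D>. countable \<E> \<and> (\<forall>D\<in>\<D>. \<exists>E\<in>\<E>. E \<subseteq> D)"
  shows False
proof -
  let ?cov = "\<lambda>n. cov (\<U> n) (R n)"
  have "\<forall>\<D>\<in>Pow \<C>. \<exists>\<E>\<subseteq>\<D>. countable \<E> \<and> (\<forall>D\<in>\<D>. \<exists>E\<in>\<E>. D \<subseteq> E)" using cofinal by blast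
  then obtain cof where "\<forall>\<D>\<in>Pow \<C>.
      cof \<D> \<subseteq> \<D> \<and> countable (cof \<D>) \<and> (\<forall>D\<in>\<D>. \<exists>E\<in>cof \<D>. D \<subseteq> E)"
    by (rule bchoice[THEN exE])
  then have cof: "cof {k \<in> \<C>. P k} \<subseteq> {k \<in> \<C>. P k}" "countable (cof {k \<in> \<C>. P k})"
    "D \<in> \<C> \<Longrightarrow> P D \<Longrightarrow> \<exists>E\<in>cof {k \<in> \<C>. P k}. D \<subseteq> E" for P D
    by simp_all
  have "\<forall>\<D>\<in>Pow \<C>. \<exists>\<E>\<subseteq>\<D>. countable \<E> \<and> (\<forall>D\<in>\<D>. \<exists>E\<in>\<E>. E \<subseteq> D)" using coinitial by blast
  then obtain coi where "\<forall>\<D>\<in>Pow \<C>.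
      coi \<D> \<subseteq> \<D> \<and> countable (coi \<D>) \<and> (\<forall>D\<in>\<D>. \<exists>E\<in>coi \<D>. E \<subseteq> D)"
    by (rule bchoice[THEN exE])
  then have coi: "coi {k \<in> \<C>. P k} \<subseteq> {k \<in> \<C>. P k}" "countable (coi {k \<in> \<C>. P k})"
    "D \<in> \<C> \<Longrightarrow> P D \<Longrightarrow> \<exists>E\<in>coi {k \<in> \<C>. P k}. E \<subseteq> D" for P D
    by simp_all
  define up where "up Q d n m = cof {k \<in> \<C>. ?cov n m (Q \<inter> (k - d))}" for Q d :: "'a set" and n m
  define down where "down Q e n m = coi {k \<in> \<C>. ?cov n m (Q \<inter> (e - k))}" for Q e :: "'a set" and n m
  define g where "g Q d e =
      range (\<lambda>n. Q - (R n \<union> \<Union>(\<U> n))) \<union> range (\<lambda>n. trim (\<U> n) (R n) Q (e - d))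
      \<union> (\<Union>n m. up Q d n m) \<union> (\<Union>n m. down Q e n m)" for Q d e :: "'a set"
  have g: "countable (g x y z)" for x y z
    unfolding g_def up_def down_def by (intro countable_Un countable_UN cof(2) coi(2)) simp_all
  have "\<exists>Z. {UNIV, {}, Y} \<subseteq> Z \<and> countable Z \<and> (\<forall>x\<in>Z. \<forall>y\<in>Z. \<forall>z\<in>Z. g x y z \<subseteq> Z)"
    by (rule countable_closure[OF _ g]) simp
  then obtain Z where Z: "{UNIV, {}, Y} \<subseteq> Z" "countable Z"
    "\<forall>x\<in>Z. \<forall>y\<in>Z. \<forall>z\<in>Z. g x y z \<subseteq> Z"
    by (elim exE conjE)
  have closedZ: "up Q d n m \<subseteq> Z" "down Q e n m \<subseteq> Z"
    "Q - (R n \<union> \<Union>(\<U> n)) \<in> Z" "trim (\<U> n) (R n) Q (e - d) \<in> Z"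
    if "Q \<in> Z" "d \<in> Z" "e \<in> Z" for Q d e n m
  proof -
    have sub: "g Q d e \<subseteq> Z" using Z(3) that by blast
    have "up Q d n m \<subseteq> g Q d e" "down Q e n m \<subseteq> g Q d e"
      "Q - (R n \<union> \<Union>(\<U> n)) \<in> g Q d e" "trim (\<U> n) (R n) Q (e - d) \<in> g Q d e"
      unfolding g_def by blast+
    then show "up Q d n m \<subseteq> Z" "down Q e n m \<subseteq> Z"
      "Q - (R n \<union> \<Union>(\<U> n)) \<in> Z" "trim (\<U> n) (R n) Q (e - d) \<in> Z"
      using sub by blast+
  qed
  have "\<not> \<C> \<subseteq> Z" using \<open>uncountable \<C>\<close> countable_subset[OF _ Z(2)] by auto
  then obtain l where l: "l \<in> \<C>" "l \<notin> Z" by blast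
  define D where "D = {d \<in> Z \<inter> \<C>. d \<subset> l}"
  define E where "E = {e \<in> Z \<inter> \<C>. l \<subset> e}"
  \<comment> \<open>The endpoints \<open>{}\<close> and \<open>Y\<close> are in the hull, so they
    differ from \<open>l\<close> and both parts are nonempty.\<close>
  have DE: "{} \<in> D" "Y \<in> E" using l Z(1) bounds unfolding D_def E_def by blast+
  define \<K> \<L> where "\<K> = (\<lambda>d. l - d) ` D" and "\<L> = (\<lambda>e. e - l) ` E"
  have K: "chain_subset \<K>" "\<K> \<noteq> {}" "\<forall>K\<in>\<K>. closed K" "{} \<notin> \<K>"
    using DE chain diff l(1) unfolding \<K>_def D_def chain_subset_def by blast+
  have L: "chain_subset \<L>" "\<L> \<noteq> {}" "\<forall>K\<in>\<L>. closed K" "{} \<notin> \<L>"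
    using DE chain diff l(1) unfolding \<L>_def E_def chain_subset_def by blast+
  define \<Q> where "\<Q> = {Q \<in> Z. closed Q}"
  define \<W> where "\<W> = (\<lambda>(d, e). e - d) ` (D \<times> E)"
  show False
  proof (rule no_twins[of \<Q> "\<Inter>\<K>" "\<Inter>\<L>" \<W>])
    show "UNIV \<in> \<Q>" "\<And>Q. Q \<in> \<Q> \<Longrightarrow> closed Q" using Z(1) by (auto simp: \<Q>_def)
    show "closed (\<Inter>\<K>)" "closed (\<Inter>\<L>)" using K(3) L(3) by blast+
    show "\<Inter>\<K> \<noteq> {}" by (rule compact_chain_Inter_nonempty[OF compact_space K])
    show "\<Inter>\<L> \<noteq> {}" by (rule compact_chain_Inter_nonempty[OF compact_space L])
    show "\<Inter>\<K> \<inter> \<Inter>\<L> = {}" using DE unfolding \<K>_def \<L>_def by blast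
    show "Q - (R n \<union> \<Union>(\<U> n)) \<in> \<Q>" if "Q \<in> \<Q>" for Q n
      using that closedZ(3)[of Q Q Q n] open_U[of n] open_R[of n]
      by (auto simp: \<Q>_def intro!: closed_Diff open_Un open_Union)
    show "trim (\<U> n) (R n) Q W \<in> \<Q>" if "Q \<in> \<Q>" "W \<in> \<W>" for Q W n
      using that closedZ(4)[of Q _ _ n] closed_trim[OF open_U open_R]
      by (auto simp: \<Q>_def \<W>_def D_def E_def)
    show "\<Inter>\<K> \<union> \<Inter>\<L> \<subseteq> W" if "W \<in> \<W>" for W
      using that unfolding \<K>_def \<L>_def \<W>_def D_def E_def by blast
    show "\<exists>W\<in>\<W>. ?cov n m (Q \<inter> W)"
      if Q: "Q \<in> \<Q>" and cov: "?cov n m (Q \<inter> \<Inter>\<K>) \<or> ?cov n m (Q \<inter> \<Inter>\<L>)" for Q m n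
    proof -
      have Q': "Q \<in> Z" "closed Q" using Q by (auto simp: \<Q>_def)
      have "\<exists>d\<in>D. \<exists>e\<in>E. ?cov n m (Q \<inter> (e - d))"
        using cov
      proof
        assume "?cov n m (Q \<inter> \<Inter>\<K>)"
        then have "\<exists>K\<in>\<K>. ?cov n m (Q \<inter> K)"
          by (rule cov_chain_Inter[OF compact_space open_U open_R K(1-3) Q'(2)])
        then obtain d where d: "d \<in> D" "?cov n m (Q \<inter> (l - d))"
          unfolding \<K>_def by blast
        \<comment> \<open>\<open>l\<close> itself belongs to the set in which
          \<open>up Q d n m\<close> is cofinal. As \<open>e\<close> will be in \<open>Z\<close> and
          \<open>l\<close> is not, the inclusion \<open>l \<subseteq> e\<close> is strict.\<close>
        then obtain e where e: "e \<in> up Q d n m" "l \<subseteq> e" "e \<in> \<C>" "?cov n m (Q \<inter> (e - d))"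
          using cof(1,3)[where P = "\<lambda>k. ?cov n m (Q \<inter> (k - d))"] l(1) unfolding up_def by blast
        have "e \<in> Z" using e(1) closedZ(1)[of Q d d n m] Q'(1) d(1) unfolding D_def by blast
        then have "e \<in> E" using e(2,3) l(2) unfolding E_def by blast
        then show ?thesis using d(1) e(4) by blast
      next
        assume "?cov n m (Q \<inter> \<Inter>\<L>)"
        then have "\<exists>K\<in>\<L>. ?cov n m (Q \<inter> K)"
          by (rule cov_chain_Inter[OF compact_space open_U open_R L(1-3) Q'(2)])
        then obtain e where e: "e \<in> E" "?cov n m (Q \<inter> (e - l))"
          unfolding \<L>_def by blast
        then obtain d where d: "d \<in> down Q e n m" "d \<subseteq> l" "d \<in> \<C>" "?cov n m (Q \<inter> (e - d))"
          using coi(1,3)[where P = "\<lambda>k. ?cov n m (Q \<inter> (e - k))"] l(1) unfolding down_def by blast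
        have "d \<in> Z" using d(1) closedZ(2)[of Q e e n m] Q'(1) e(1) unfolding E_def by blast
        then have "d \<in> D" using d(2,3) l(2) unfolding D_def by blast
        then show ?thesis using e(1) d(4) by blast
      qed
      then show ?thesis unfolding \<W>_def by blast
    qed
  qed
qed

text \<open>A subchain without a countable cofinal subset has a strict upper bound, within itself,
  for each of its countable subsets, so the directed case applies. Without a countable coinitial
  subset, the same holds for the complements in \<open>Y\<close>, and complementing merely exchanges
  the two sets in a difference.\<close>

lemma uncountable_chain_False:
  fixes \<C> :: "'a set set"
  assumes chain: "chain_subset \<C>" and diff: "\<forall>C\<in>\<C>. \<forall>D\<in>\<C>. closed (C - D)"
    and bounds: "{} \<in> \<C>" "Y \<in> \<C>" "\<forall>C\<in>\<C>. C \<subseteq> Y" and "uncountable \<C>"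
  shows False
proof (rule countable_cofinality_chain_False[OF assms])
  fix \<D> assume D: "\<D> \<subseteq> \<C>"
  show "\<exists>\<E>\<subseteq>\<D>. countable \<E> \<and> (\<forall>D\<in>\<D>. \<exists>E\<in>\<E>. D \<subseteq> E)"
  proof (rule ccontr)
    assume no: "\<not> ?thesis"
    show False
    proof (rule countably_directed_chain_False)
      show chD: "chain_subset \<D>" using chain D by (rule chain_subset_mono)
      show "\<forall>C\<in>\<D>. \<forall>D\<in>\<D>. closed (C - D)" using diff D by blast
      fix \<E> assume E: "\<E> \<subseteq> \<D>" "countable \<E>"
      then have "\<not> (\<forall>D\<in>\<D>. \<exists>E\<in>\<E>. D \<subseteq> E)" using no by meson
      then obtain C where C: "C \<in> \<D>" "\<forall>E\<in>\<E>. \<not> C \<subseteq> E" by meson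
      have "E \<subset> C" if "E \<in> \<E>" for E
      proof -
        have "\<not> C \<subseteq> E" "E \<in> \<D>" using C(2) E(1) that by auto
        then show ?thesis using chD C(1) unfolding chain_subset_def by auto
      qed
      then show "\<exists>C\<in>\<D>. \<forall>E\<in>\<E>. E \<subset> C" using C(1) by auto
    qed
  qed
  show "\<exists>\<E>\<subseteq>\<D>. countable \<E> \<and> (\<forall>D\<in>\<D>. \<exists>E\<in>\<E>. E \<subseteq> D)"
  proof (rule ccontr)
    assume no: "\<not> ?thesis"
    have sub: "\<forall>D\<in>\<D>. D \<subseteq> Y" using D bounds(3) by blast
    show False
    proof (rule countably_directed_chain_False)
      show "chain_subset ((\<lambda>D. Y - D) ` \<D>)" using chain D unfolding chain_subset_def by blast
      have "closed ((Y - C) - (Y - D))" if "C \<in> \<D>" "D \<in> \<D>" for C D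
      proof -
        have "(Y - C) - (Y - D) = D - C" using sub that by blast
        then show ?thesis using diff D that by auto
      qed
      then show "\<forall>C\<in>(\<lambda>D. Y - D) ` \<D>. \<forall>D\<in>(\<lambda>D. Y - D) ` \<D>. closed (C - D)" by blast
      fix \<F> assume "\<F> \<subseteq> (\<lambda>D. Y - D) ` \<D>" "countable \<F>"
      then obtain \<E> where E: "countable \<E>" "\<E> \<subseteq> \<D>" "\<F> = (\<lambda>D. Y - D) ` \<E>"
        using countable_subset_image[of \<F> "\<lambda>D. Y - D" \<D>] by blast
      then have "\<not> (\<forall>D\<in>\<D>. \<exists>E\<in>\<E>. E \<subseteq> D)" using no by meson
      then obtain C where C: "C \<in> \<D>" "\<forall>E\<in>\<E>. \<not> E \<subseteq> C" by meson
      have "Y - E \<subset> Y - C" if "E \<in> \<E>" for E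
      proof -
        have "\<not> E \<subseteq> C" "E \<in> \<D>" using C(2) E(2) that by auto
        moreover have "C \<subseteq> E"
          using calculation C(1) chain_subset_mono[OF chain D] unfolding chain_subset_def by auto
        ultimately show ?thesis using sub by blast
      qed
      then have "\<forall>E\<in>\<F>. E \<subset> Y - C" unfolding E(3) by simp
      then show "\<exists>C\<in>(\<lambda>D. Y - D) ` \<D>. \<forall>E\<in>\<F>. E \<subset> C" using C(1) by (rule bexI[OF _ imageI])
    qed
  qed
qed

end

lemma gruenhage_imp_family:
  assumes "compact (UNIV :: 'a::topological_space set)" "gruenhage TYPE('a)"
  shows "\<exists>(\<U> :: nat \<Rightarrow> 'a set set) R. gruenhage_family \<U> R"
proof -
  obtain \<U> :: "nat \<Rightarrow> 'a set set" and R where UR: "\<forall>n. \<forall>U\<in>\<U> n. open U" "\<forall>n. open (R n)"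
      "\<forall>n. \<forall>U\<in>\<U> n. \<forall>V\<in>\<U> n. U \<noteq> V \<longrightarrow> U \<inter> V = R n"
      "\<forall>s t. s \<noteq> t \<longrightarrow> (\<exists>m. \<exists>U\<in>\<U> m. is_singleton ({s, t} \<inter> U))"
    using assms(2) unfolding gruenhage_def by (elim exE conjE)
  \<comment> \<open>If \<open>\<U> n\<close> has at most one member, then \<open>R n\<close> is unconstrained and must be replaced.\<close>
  define R' where "R' n = (if \<exists>U\<in>\<U> n. \<exists>V\<in>\<U> n. U \<noteq> V then R n else {})" for n
  have "R' n \<subseteq> U" if U: "U \<in> \<U> n" for n U
  proof (cases "\<exists>V\<in>\<U> n. U \<noteq> V")
    case True
    then obtain V where "V \<in> \<U> n" "U \<noteq> V" by blast
    then have "U \<inter> V = R n" "R' n = R n" using UR(3) U unfolding R'_def by auto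
    then show ?thesis by blast
  next
    case False
    then have "R' n = {}" unfolding R'_def by auto
    then show ?thesis by simp
  qed
  moreover have "\<forall>U\<in>\<U> n. \<forall>V\<in>\<U> n. U \<noteq> V \<longrightarrow> U \<inter> V = R' n" for n
    using UR(3) unfolding R'_def by auto
  moreover have "open (R' n)" for n using UR(2) unfolding R'_def by simp
  ultimately have "gruenhage_family \<U> R'"
    using assms(1) UR(1,4) by unfold_locales simp_all
  then show ?thesis by blast
qed

section \<open>Separated chains of functions\<close>

lemma exists_norm_diff_ge:
  fixes f g :: "'a::topological_space \<Rightarrow>\<^sub>C 'b::real_normed_vector"
  assumes "compact (UNIV :: 'a set)" "\<delta> \<le> norm (f - g)"
  obtains t where "\<delta> \<le> norm (apply_bcontfun f t - apply_bcontfun g t)"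
proof -
  have "continuous_on UNIV (\<lambda>t. norm (apply_bcontfun f t - apply_bcontfun g t))"
    by (intro continuous_intros continuous_on_apply_bcontfun)
  then obtain t where
    "\<forall>s. norm (apply_bcontfun f s - apply_bcontfun g s) \<le> norm (apply_bcontfun f t - apply_bcontfun g t)"
    using continuous_attains_sup[OF assms(1)] by blast
  then have "norm (f - g) \<le> norm (apply_bcontfun f t - apply_bcontfun g t)"
    by (intro norm_bound) simp
  with assms(2) show thesis by (rule that[OF order_trans])
qed

lemma separated_prec_chain_imp_set_chain:
  fixes F :: "('a::topological_space \<Rightarrow>\<^sub>C 'b::real_normed_vector) set"
  assumes compact: "compact (UNIV :: 'a set)" and "uncountable F" and chain: "prec_chain F"
    and "\<delta> > 0" and sep: "\<forall>f\<in>F. \<forall>g\<in>F. prec f g \<longrightarrow> \<delta> \<le> norm (f - g)"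
  obtains \<C> :: "'a set set" and Y where "chain_subset \<C>" "\<forall>C\<in>\<C>. \<forall>D\<in>\<C>. closed (C - D)"
    "{} \<in> \<C>" "Y \<in> \<C>" "\<forall>C\<in>\<C>. C \<subseteq> Y" "uncountable \<C>"
proof -
  define Y where "Y = (\<Inter>f\<in>F. {t. apply_bcontfun f t = 0} \<union> {t. \<delta> \<le> norm (apply_bcontfun f t)})"
  define c where "c f = Y \<inter> {t. \<delta> \<le> norm (apply_bcontfun f t)}" for f :: "'a \<Rightarrow>\<^sub>C 'b"
  have cont: "continuous_on UNIV (apply_bcontfun f)" for f :: "'a \<Rightarrow>\<^sub>C 'b" by simp
  have zero: "closed {t. apply_bcontfun f t = 0}" for f :: "'a \<Rightarrow>\<^sub>C 'b"
    by (intro closed_Collect_eq cont continuous_on_const)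
  have large: "closed {t. \<delta> \<le> norm (apply_bcontfun f t)}" for f :: "'a \<Rightarrow>\<^sub>C 'b"
    by (intro closed_Collect_le continuous_on_norm cont continuous_on_const)
  have Y: "closed Y" unfolding Y_def by (intro closed_INT ballI closed_Un zero large)
  have c: "closed (c f)" for f unfolding c_def by (intro closed_Int Y large)
  \<comment> \<open>Inside \<open>Y\<close> the complement of \<open>c f\<close> is the zero set of
    \<open>f\<close>. Thus \<open>c f\<close> is clopen in \<open>Y\<close>, which makes all
    differences closed.\<close>
  have co: "X - c f = X \<inter> {t. apply_bcontfun f t = 0}" if "f \<in> F" "X \<subseteq> Y" for X f
    using that \<open>\<delta> > 0\<close> unfolding c_def Y_def by force
  have agree: "apply_bcontfun g t = apply_bcontfun f t" if "prec f g" "apply_bcontfun f t \<noteq> 0"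
    for f g :: "'a \<Rightarrow>\<^sub>C 'b" and t
  proof -
    have "{t. apply_bcontfun f t \<noteq> 0} \<subseteq> supp f" unfolding supp_def by (rule closure_subset)
    then have "t \<in> supp f" using that(2) by auto
    then show ?thesis using that(1) unfolding prec_def by simp
  qed
  have mono: "c f \<subseteq> c g" if "prec f g" for f g
  proof
    fix t assume t: "t \<in> c f"
    then have "apply_bcontfun f t \<noteq> 0" using \<open>\<delta> > 0\<close> unfolding c_def by auto
    then show "t \<in> c g" using t agree[OF that] unfolding c_def by simp
  qed
  have ne: "c f \<noteq> c g" if fg: "f \<in> F" "g \<in> F" "prec f g" for f g
  proof -
    have "\<delta> \<le> norm (f - g)" using sep fg by simp
    then obtain t where t: "\<delta> \<le> norm (apply_bcontfun f t - apply_bcontfun g t)"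
      by (rule exists_norm_diff_ge[OF compact])
    \<comment> \<open>Where \<open>f\<close> does not vanish, \<open>g\<close> agrees with it, so
      the difference would be 0.\<close>
    then have ft: "apply_bcontfun f t = 0" using agree[OF fg(3), of t] \<open>\<delta> > 0\<close> by force
    then have gt: "\<delta> \<le> norm (apply_bcontfun g t)" using t by simp
    then have "apply_bcontfun g t \<noteq> 0" using \<open>\<delta> > 0\<close> by auto
    have "apply_bcontfun k t = 0 \<or> \<delta> \<le> norm (apply_bcontfun k t)" if "k \<in> F" for k
    proof -
      \<comment> \<open>Any \<open>k\<close> comparable with \<open>g\<close> takes at
        \<open>t\<close> the value 0 or the value of \<open>g\<close>; this puts \<open>t\<close>
        into \<open>Y\<close>.\<close>
      have "k = g \<or> prec k g \<or> prec g k" using chain that \<open>g \<in> F\<close> unfolding prec_chain_def by auto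
      then have "apply_bcontfun k t = 0 \<or> apply_bcontfun k t = apply_bcontfun g t"
        using agree[of k g t] agree[of g k t] \<open>apply_bcontfun g t \<noteq> 0\<close> by metis
      then show ?thesis using gt by auto
    qed
    then have "t \<in> c g" using gt unfolding c_def Y_def by simp
    moreover have "t \<notin> c f" using ft \<open>\<delta> > 0\<close> unfolding c_def by simp
    ultimately show ?thesis by blast
  qed
  have inj: "inj_on c F"
  proof (rule inj_onI, rule ccontr)
    fix f g assume "f \<in> F" "g \<in> F" "c f = c g" "f \<noteq> g"
    then show False using ne[of f g] ne[of g f] chain unfolding prec_chain_def by metis
  qed
  have unc: "uncountable (c ` F)"
    using \<open>uncountable F\<close> unfolding countable_image_inj_eq[OF inj] .
  have cY: "c f \<subseteq> Y" for f unfolding c_def by blast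
  have "c f \<subseteq> c g \<or> c g \<subseteq> c f" if "f \<in> F" "g \<in> F" for f g
    using chain that mono[of f g] mono[of g f] unfolding prec_chain_def by (cases "f = g") auto
  then have 1: "chain_subset (insert {} (insert Y (c ` F)))"
    using cY unfolding chain_subset_def by auto
  have "closed X \<and> X \<subseteq> Y" if "X \<in> insert {} (insert Y (c ` F))" for X
    using that Y c cY by auto
  moreover have "closed (X - D)"
    if D: "D \<in> insert {} (insert Y (c ` F))" and X: "closed X \<and> X \<subseteq> Y" for X D
  proof -
    from D consider "D = {}" | "D = Y" | f where "f \<in> F" "D = c f" by blast
    then show ?thesis
    proof cases
      case 2
      then have "X - D = {}" using X by blast
      then show ?thesis by (simp only: closed_empty)
    next
      case 3
      then show ?thesis using co[of f X] X zero[of f] by (simp add: closed_Int)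
    qed (use X in simp)
  qed
  ultimately have 2: "\<forall>C\<in>insert {} (insert Y (c ` F)). \<forall>D\<in>insert {} (insert Y (c ` F)). closed (C - D)"
    by (intro ballI) simp
  from 1 2 show thesis by (rule that[of _ Y]) (use unc cY in simp_all)
qed

lemma gruenhage_imp_bishop_property:
  assumes "compact (UNIV :: 'a::topological_space set)" "gruenhage TYPE('a)"
  shows "bishop_property TYPE('a) TYPE('b::real_normed_field)"
  unfolding bishop_property_def
proof (intro allI impI)
  fix F :: "('a \<Rightarrow>\<^sub>C 'b) set"
  assume F: "uncountable F" "prec_chain F"
  define S where "S = {norm (f - g) | f g. f \<in> F \<and> g \<in> F \<and> prec f g}"
  \<comment> \<open>The lower bound for \<open>Inf S\<close> needs a nonempty set; an uncountable
    chain has two distinct, hence comparable, members.\<close>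
  have "S \<noteq> {}"
  proof -
    have "\<not> F \<subseteq> {undefined}" using F(1) countable_subset[of F "{undefined}"] by auto
    then obtain f where f: "f \<in> F" by blast
    have "\<not> F \<subseteq> {f}" using F(1) countable_subset[of F "{f}"] by auto
    then obtain g where "g \<in> F" "g \<noteq> f" by blast
    then have "prec f g \<or> prec g f" using F(2) f unfolding prec_chain_def by auto
    then show ?thesis using f \<open>g \<in> F\<close> unfolding S_def by blast
  qed
  have pos: "\<And>s. s \<in> S \<Longrightarrow> 0 \<le> s" unfolding S_def by auto
  then have "0 \<le> Inf S" using \<open>S \<noteq> {}\<close> by (intro cInf_greatest) auto
  moreover have "\<not> 0 < Inf S"
  proof
    assume "0 < Inf S"
    have "bdd_below S" using pos by (rule bdd_belowI)
    \<comment> \<open>A positive infimum itself serves as the separation constant \<delta>.\<close>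
    then have sep: "\<forall>f\<in>F. \<forall>g\<in>F. prec f g \<longrightarrow> Inf S \<le> norm (f - g)"
      unfolding S_def by (auto intro!: cInf_lower)
    obtain \<C> :: "'a set set" and Y where
      C: "chain_subset \<C>" "\<forall>C\<in>\<C>. \<forall>D\<in>\<C>. closed (C - D)" "{} \<in> \<C>" "Y \<in> \<C>" "\<forall>C\<in>\<C>. C \<subseteq> Y"
        "uncountable \<C>"
      by (rule separated_prec_chain_imp_set_chain[OF assms(1) F \<open>0 < Inf S\<close> sep])
    obtain \<U> :: "nat \<Rightarrow> 'a set set" and R where "gruenhage_family \<U> R"
      using gruenhage_imp_family[OF assms] by (elim exE)
    then show False using C by (rule gruenhage_family.uncountable_chain_False)
  qed
  ultimately show "Inf {norm (f - g) | f g. f \<in> F \<and> g \<in> F \<and> prec f g} = 0"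
    unfolding S_def by linarith
qed

theorem mainTheorem3:
  assumes "compact (UNIV :: 'a::t2_space set)"
    and "gruenhage TYPE('a)"
  shows "bishop_property TYPE('a) TYPE(real) \<and> bishop_property TYPE('a) TYPE(complex)"
  by (intro conjI gruenhage_imp_bishop_property assms)

end
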